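(* Let $\tau>0$ and $$\mathcal{A}=\begin{pmatrix}\tau A & M\\ M & -\tau B\end{pmatrix},\qquad \tilde{\mathcal{B}}=\begin{pmatrix}\tau A & M\\ \bar M & -\tau B\end{pmatrix}.$$ If $A=B$, then $$\sigma(\tilde{\mathcal{B}}^{-1}\mathcal{A})\subset (C_1,1],$$ where $C_1\in(0,1)$ is the constant, independent of $h$, in the norm equivalence $C_1(\bar M w,w)\le (Mw,w)\le(\bar M w,w)$ for all $w\in\mathbb{R}^{N_h}$.
   Context: Let $\Omega\subset\mathbb{R}^d$, $d\ge 1$, be a bounded polyhedral domain. The diffusion coefficients $a(x),b(x)$ are measurable (scalar, or symmetric matrix valued) functions on $\Omega$ satisfying the continuity and coercivity conditions $\lambda_a(x)|\xi|^2\le \xi^Ta(x)\xi\le\Lambda_a(x)|\xi|^2$ and $\lambda_b(x)|\xi|^2\le \xi^Tb(x)\xi\le\Lambda_b(x)|\xi|^2$ for all $\xi\in\mathbb{R}^d$, where $\lambda_a,\lambda_b$ are bounded below by positive constants and $\Lambda_a,\Lambda_b$ are bounded above. Let $\mathcal{T}$ be a shape-regular triangulation of $\Omega$ with meshsize $h$, and let $\mathbb{V}_{\mathcal{T}}\subset H^1_0(\Omega)$ be the space of continuous piecewise linear finite element functions over $\mathcal{T}$ vanishing on $\partial\Omega$, with nodal basis $\phi_1,\dots,\phi_{N_h}$, $N_h=\dim\mathbb{V}_{\mathcal{T}}$. Define the $N_h\times N_h$ matrices $$M_{ij}=\int_\Omega\phi_i\phi_j,\quad A_{ij}=\int_\Omega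 a\nabla\phi_i\cdot\nabla\phi_j,\quad B_{ij}=\int_\Omega b\nabla\phi_i\cdot\nabla\phi_j .$$ The lumped mass matrix $\bar M$ is the diagonal matrix whose diagonal entries are the row sums of $M$. $(\cdot,\cdot)$ applied to vectors is the Euclidean inner product and $\sigma(\cdot)$ denotes the spectrum. A constant $C_1\in(0,1)$ independent of $h$ with $C_1(\bar M w,w)\le (Mw,w)\le(\bar M w,w)$ for all $w\in\mathbb{R}^{N_h}$ is known to exist and is fixed. No relation between $\tau$ and $h$ is assumed. *)

theory Defs
  imports "HOL-Analysis.Analysis" "Jordan_Normal_Form.Spectral_Radius"
    "Jordan_Normal_Form.Gauss_Jordan_Elimination"
begin

text \<open>HOL-Analysis and Jordan_Normal_Form overload several names. Points of the domain and the
  pointwise coefficients live in the Cartesian types of HOL-Analysis; the finite element matrices,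
  whose size varies with the mesh, are matrices of Jordan_Normal_Form.\<close>

section \<open>Domain and coefficients\<close>

definition polyhedral_domain :: "(real ^ 'd) set \<Rightarrow> bool" where
  "polyhedral_domain \<Omega> \<longleftrightarrow> open \<Omega> \<and> connected \<Omega> \<and> \<Omega> \<noteq> {} \<and> bounded \<Omega> \<and>
     (\<exists>\<F>. finite \<F> \<and> (\<forall>P\<in>\<F>. polytope P \<and> aff_dim P = int CARD('d) - 1) \<and> frontier \<Omega> = \<Union>\<F>)"

text \<open>A scalar coefficient \<open>\<alpha>\<close> is the special case where \<open>a x\<close> is \<open>\<alpha> x\<close> times the identity.\<close>

definition diffusion_coefficient :: "(real ^ 'd) set \<Rightarrow> (real ^ 'd \<Rightarrow> real ^ 'd ^ 'd) \<Rightarrow> bool" where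
  "diffusion_coefficient \<Omega> a \<longleftrightarrow>
     a \<in> borel_measurable (lebesgue_on \<Omega>) \<and>
     (\<forall>x\<in>\<Omega>. transpose (a x) = a x) \<and>
     (\<exists>lam Lam :: real ^ 'd \<Rightarrow> real.
        (\<forall>x\<in>\<Omega>. \<forall>\<xi>. lam x * (norm \<xi>)\<^sup>2 \<le> inner \<xi> (a x *v \<xi>) \<and> inner \<xi> (a x *v \<xi>) \<le> Lam x * (norm \<xi>)\<^sup>2) \<and>
        (\<exists>c>0. \<forall>x\<in>\<Omega>. c \<le> lam x) \<and> (\<exists>C. \<forall>x\<in>\<Omega>. Lam x \<le> C))"

section \<open>Meshes\<close>

text \<open>The constant \<open>triangulation\<close> of HOL-Analysis demands finiteness and that two simplices meet
  in a common face. The last conjunct says that the mesh resolves the boundary; it is automatic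
  unless \<open>\<Omega>\<close> has points of its boundary in the interior of its closure (slits).\<close>

definition mesh :: "(real ^ 'd) set \<Rightarrow> (real ^ 'd) set set \<Rightarrow> bool" where
  "mesh \<Omega> \<T> \<longleftrightarrow> triangulation \<T> \<and> (\<forall>K\<in>\<T>. int CARD('d) simplex K) \<and> \<Union>\<T> = closure \<Omega> \<and>
     (\<exists>\<F>. (\<forall>F\<in>\<F>. \<exists>K\<in>\<T>. F face_of K) \<and> frontier \<Omega> = \<Union>\<F>)"

definition inradius :: "(real ^ 'd) set \<Rightarrow> real" where
  "inradius K = Sup {r. 0 \<le> r \<and> (\<exists>x. cball x r \<subseteq> K)}"

text \<open>Shape regularity is a property of a family of meshes: one constant serves all members.\<close>

definition shape_regular :: "(real ^ 'd) set set set \<Rightarrow> bool" where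
  "shape_regular \<M> \<longleftrightarrow> (\<exists>\<kappa>>0. \<forall>\<T>\<in>\<M>. \<forall>K\<in>\<T>. diameter K \<le> \<kappa> * inradius K)"

section \<open>Piecewise linear finite elements\<close>

text \<open>Functions on the closure of \<open>\<Omega>\<close> vanishing on the boundary are represented by their
  extension by zero.\<close>

definition fe_space :: "(real ^ 'd) set \<Rightarrow> (real ^ 'd) set set \<Rightarrow> (real ^ 'd \<Rightarrow> real) set" where
  "fe_space \<Omega> \<T> = {u. continuous_on (closure \<Omega>) u \<and>
     (\<forall>K\<in>\<T>. \<exists>g c. \<forall>x\<in>K. u x = inner g x + c) \<and> (\<forall>x. x \<notin> \<Omega> \<longrightarrow> u x = 0)}"

definition nodes :: "(real ^ 'd) set \<Rightarrow> (real ^ 'd) set set \<Rightarrow> (real ^ 'd) set" where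
  "nodes \<Omega> \<T> = {v \<in> \<Omega>. \<exists>K\<in>\<T>. v extreme_point_of K}"

definition nodal_basis ::
  "(real ^ 'd) set \<Rightarrow> (real ^ 'd) set set \<Rightarrow> (real ^ 'd \<Rightarrow> real) list \<Rightarrow> bool" where
  "nodal_basis \<Omega> \<T> \<phi> \<longleftrightarrow> (\<exists>vs. distinct vs \<and> set vs = nodes \<Omega> \<T> \<and> length \<phi> = length vs \<and>
     (\<forall>i<length vs. \<phi> ! i \<in> fe_space \<Omega> \<T> \<and>
        (\<forall>j<length vs. (\<phi> ! i) (vs ! j) = (if i = j then 1 else 0))))"

text \<open>The classical gradient. A finite element function is affine on each simplex, so it is
  differentiable off the null set of simplex boundaries, and there the classical gradient is its
  weak gradient. The arbitrary value elsewhere does not affect integrals.\<close>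

definition grad :: "(real ^ 'd \<Rightarrow> real) \<Rightarrow> real ^ 'd \<Rightarrow> real ^ 'd" where
  "grad u x = (THE D. GDERIV u x :> D)"

section \<open>Matrices\<close>

definition mass_matrix :: "(real ^ 'd) set \<Rightarrow> (real ^ 'd \<Rightarrow> real) list \<Rightarrow> real mat" where
  "mass_matrix \<Omega> \<phi> = Matrix.mat (length \<phi>) (length \<phi>)
     (\<lambda>(i, j). LINT x|lebesgue_on \<Omega>. (\<phi> ! i) x * (\<phi> ! j) x)"

definition stiffness_matrix ::
  "(real ^ 'd) set \<Rightarrow> (real ^ 'd \<Rightarrow> real ^ 'd ^ 'd) \<Rightarrow> (real ^ 'd \<Rightarrow> real) list \<Rightarrow> real mat" where
  "stiffness_matrix \<Omega> a \<phi> = Matrix.mat (length \<phi>) (length \<phi>)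
     (\<lambda>(i, j). LINT x|lebesgue_on \<Omega>. inner (a x *v grad (\<phi> ! i) x) (grad (\<phi> ! j) x))"

definition lumped :: "real mat \<Rightarrow> real mat" where
  "lumped M = Matrix.mat (dim_row M) (dim_row M)
     (\<lambda>(i, j). if i = j then \<Sum>k<dim_col M. M $$ (i, k) else 0)"

definition calA :: "real \<Rightarrow> real mat \<Rightarrow> real mat \<Rightarrow> real mat \<Rightarrow> real mat" where
  "calA \<tau> A B M = four_block_mat (\<tau> \<cdot>\<^sub>m A) M M (- (\<tau> \<cdot>\<^sub>m B))"

definition calB_tilde :: "real \<Rightarrow> real mat \<Rightarrow> real mat \<Rightarrow> real mat \<Rightarrow> real mat" where
  "calB_tilde \<tau> A B M = four_block_mat (\<tau> \<cdot>\<^sub>m A) M (lumped M) (- (\<tau> \<cdot>\<^sub>m B))"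

end

theory Submission
  imports Defs
begin

text \<open>Let \<open>K = \<tau> A = \<tau> B\<close>, let \<open>L\<close> be the lumped mass matrix and let \<open>(z, y)\<close> be an eigenvector for
  \<open>\<mu> \<noteq> 1\<close>. The first block row gives \<open>K z = - M y\<close>. Pairing the second block row with the conjugate
  of \<open>z\<close> and using the symmetry of \<open>K\<close> yields \<open>(M z, z) + (M y, y) = \<mu> ((L z, z) + (M y, y))\<close>, so \<open>\<mu>\<close> is
  real. Since \<open>K\<close> is injective, \<open>y \<noteq> 0\<close>, and \<open>(M y, y) > 0\<close> makes the lower bound \<open>C\<^sub>1\<close> strict. It remains
  that the mass and stiffness matrices are symmetric positive definite: a finite element function
  whose gradient vanishes almost everywhere is constant on each simplex, hence constant on the
  connected closure of the domain, hence zero.\<close>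

section \<open>Block matrices of saddle point form\<close>

definition symmetric_form :: "nat \<Rightarrow> real mat \<Rightarrow> bool" where
  "symmetric_form n P \<longleftrightarrow> P \<in> carrier_mat n n \<and> (\<forall>i<n. \<forall>j<n. P $$ (i, j) = P $$ (j, i))"

definition positive_form :: "nat \<Rightarrow> real mat \<Rightarrow> bool" where
  "positive_form n P \<longleftrightarrow> symmetric_form n P \<and>
     (\<forall>w\<in>carrier_vec n. w \<noteq> 0\<^sub>v n \<longrightarrow> 0 < scalar_prod (P *\<^sub>v w) w)"

text \<open>For symmetric \<open>P\<close> this is the real number \<open>z* P z\<close>. Built from
  real vectors, it inherits real inequalities between quadratic forms, applied to the real and
  imaginary parts separately.\<close>

definition hermitian_form :: "real mat \<Rightarrow> complex Matrix.vec \<Rightarrow> real" where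
  "hermitian_form P z =
     scalar_prod (P *\<^sub>v map_vec Re z) (map_vec Re z) + scalar_prod (P *\<^sub>v map_vec Im z) (map_vec Im z)"

lemma symmetric_form_carrier: "symmetric_form n P \<Longrightarrow> P \<in> carrier_mat n n"
  by (simp add: symmetric_form_def)

lemma mult_scalar_prod_sum:
  assumes "P \<in> carrier_mat n n" "v \<in> carrier_vec n" "w \<in> carrier_vec n"
  shows "scalar_prod (P *\<^sub>v v) w = (\<Sum>i<n. \<Sum>j<n. P $$ (i, j) * vec_index v j * vec_index w i)"
  using assms
  by (auto simp: scalar_prod_def atLeast0LessThan sum_distrib_right intro!: sum.cong)

lemma symmetric_form_swap:
  assumes "symmetric_form n P" "v \<in> carrier_vec n" "w \<in> carrier_vec n"
  shows "scalar_prod (P *\<^sub>v v) w = scalar_prod (P *\<^sub>v w) v"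
proof -
  have P: "P \<in> carrier_mat n n" and sym: "\<And>i j. i < n \<Longrightarrow> j < n \<Longrightarrow> P $$ (i, j) = P $$ (j, i)"
    using assms(1) by (auto simp: symmetric_form_def)
  have "scalar_prod (P *\<^sub>v v) w = (\<Sum>j<n. \<Sum>i<n. P $$ (i, j) * vec_index v j * vec_index w i)"
    unfolding mult_scalar_prod_sum[OF P assms(2,3)] by (rule sum.swap)
  also have "\<dots> = (\<Sum>j<n. \<Sum>i<n. P $$ (j, i) * vec_index w i * vec_index v j)"
    by (intro sum.cong refl) (simp add: sym)
  finally show ?thesis
    unfolding mult_scalar_prod_sum[OF P assms(3,2)] .
qed

text \<open>\<open>scalar_prod\<close> is bilinear, so the conjugate of the sesquilinear product is
  written out. The split into real pairings reduces Hermitian symmetry to the symmetry of the real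
  matrix.\<close>

lemma complex_mult_scalar_prod:
  assumes P: "P \<in> carrier_mat n n" and "y \<in> carrier_vec n" "z \<in> carrier_vec n"
  shows "scalar_prod (map_mat complex_of_real P *\<^sub>v y) (conjugate z) =
    Complex
      (scalar_prod (P *\<^sub>v map_vec Re y) (map_vec Re z) + scalar_prod (P *\<^sub>v map_vec Im y) (map_vec Im z))
      (scalar_prod (P *\<^sub>v map_vec Im y) (map_vec Re z) - scalar_prod (P *\<^sub>v map_vec Re y) (map_vec Im z))"
    (is "?l = ?r")
proof -
  have "?l = (\<Sum>i<n. \<Sum>j<n. complex_of_real (P $$ (i, j)) * vec_index y j * cnj (vec_index z i))"
    using assms by (auto simp: scalar_prod_def atLeast0LessThan sum_distrib_right intro!: sum.cong)
  also have "\<dots> = ?r"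
    using assms
    by (intro complex_eqI)
      (simp_all add: mult_scalar_prod_sum[OF P] sum.distrib sum_subtractf sum_negf algebra_simps)
  finally show ?thesis .
qed

lemma hermitian_form_complex:
  assumes "symmetric_form n P" "z \<in> carrier_vec n"
  shows "scalar_prod (map_mat complex_of_real P *\<^sub>v z) (conjugate z) = complex_of_real (hermitian_form P z)"
  using symmetric_form_swap[OF assms(1), of "map_vec Im z" "map_vec Re z"] assms
  by (simp add: complex_mult_scalar_prod[OF symmetric_form_carrier] hermitian_form_def complex_eq_iff)

lemma complex_mult_scalar_prod_swap:
  assumes "symmetric_form n P" "y \<in> carrier_vec n" "z \<in> carrier_vec n"
  shows "scalar_prod (map_mat complex_of_real P *\<^sub>v y) (conjugate z)
    = cnj (scalar_prod (map_mat complex_of_real P *\<^sub>v z) (conjugate y))"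
  using assms symmetric_form_swap[OF assms(1)]
  by (simp add: complex_mult_scalar_prod[OF symmetric_form_carrier] complex_eq_iff)

text \<open>A nonzero complex vector has a nonzero real or imaginary part, which contributes
  strictly, while the other part contributes a nonnegative amount.\<close>

lemma hermitian_form_pos:
  assumes "positive_form n P" "z \<in> carrier_vec n" "z \<noteq> 0\<^sub>v n"
  shows "0 < hermitian_form P z"
proof -
  have nonneg: "0 \<le> scalar_prod (P *\<^sub>v w) w" if "w \<in> carrier_vec n" for w
    using assms(1) that
    by (cases "w = 0\<^sub>v n") (auto simp: positive_form_def symmetric_form_def less_imp_le)
  have "map_vec Re z \<noteq> 0\<^sub>v n \<or> map_vec Im z \<noteq> 0\<^sub>v n"
  proof (rule ccontr)
    assume c: "\<not> ?thesis"
    have "vec_index z i = 0" if "i < n" for i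
      using c assms(2) that index_map_vec(1)[of i z Re] index_map_vec(1)[of i z Im]
      by (simp add: complex_eq_iff)
    with assms(2,3) show False by auto
  qed
  with assms(1,2) nonneg[of "map_vec Re z"] nonneg[of "map_vec Im z"] show ?thesis
    unfolding hermitian_form_def positive_form_def
    by (auto intro: add_pos_nonneg add_nonneg_pos)
qed

section \<open>The generalized eigenvalue problem\<close>

text \<open>The eigenvalue equation is kept in the inverse-free form of a matrix pencil, written out
  by block rows.\<close>

lemma pencil_eigenvalue:
  fixes \<mu> :: complex
  assumes M: "positive_form n M" and K: "positive_form n K" and L: "symmetric_form n L"
    and C: "0 < C" "C < 1"
    and equiv: "\<And>w. w \<in> carrier_vec n \<Longrightarrow>
        C * scalar_prod (L *\<^sub>v w) w \<le> scalar_prod (M *\<^sub>v w) w \<and>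
        scalar_prod (M *\<^sub>v w) w \<le> scalar_prod (L *\<^sub>v w) w"
    and z: "z \<in> carrier_vec n" and y: "y \<in> carrier_vec n" and nz: "z \<noteq> 0\<^sub>v n \<or> y \<noteq> 0\<^sub>v n"
  defines "cM \<equiv> map_mat complex_of_real M" and "cK \<equiv> map_mat complex_of_real K"
    and "cL \<equiv> map_mat complex_of_real L"
  assumes row1: "cK *\<^sub>v z + cM *\<^sub>v y = \<mu> \<cdot>\<^sub>v (cK *\<^sub>v z + cM *\<^sub>v y)"
    and row2: "cM *\<^sub>v z - cK *\<^sub>v y = \<mu> \<cdot>\<^sub>v (cL *\<^sub>v z - cK *\<^sub>v y)"
  shows "\<mu> \<in> complex_of_real ` {C<..1}"
proof (cases "\<mu> = 1")
  case True
  with C show ?thesis by (auto intro!: image_eqI[of _ _ 1])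
next
  case False
  have sym: "symmetric_form n M" "symmetric_form n K"
    using M K by (auto simp: positive_form_def)
  have car: "cM \<in> carrier_mat n n" "cK \<in> carrier_mat n n" "cL \<in> carrier_mat n n"
    using symmetric_form_carrier[OF sym(1)] symmetric_form_carrier[OF sym(2)]
      symmetric_form_carrier[OF L] by (auto simp: cM_def cK_def cL_def)
  \<comment> \<open>Both block matrices have the same first block row, so its value equals
    \<open>\<mu>\<close> times itself, and \<open>\<mu> \<noteq> 1\<close> forces it to
    vanish.\<close>
  have row1': "vec_index (cK *\<^sub>v z) i + vec_index (cM *\<^sub>v y) i = 0" if "i < n" for i
  proof -
    have "vec_index (cK *\<^sub>v z) i + vec_index (cM *\<^sub>v y) i
        = \<mu> * (vec_index (cK *\<^sub>v z) i + vec_index (cM *\<^sub>v y) i)"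
      using arg_cong[OF row1, of "\<lambda>v. vec_index v i"] car z y that by simp
    with False show ?thesis by (metis mult_cancel_right1)
  qed
  have hK: "scalar_prod (cK *\<^sub>v z) (conjugate y) = - scalar_prod (cM *\<^sub>v y) (conjugate y)"
  proof -
    have "(\<Sum>i<n. (vec_index (cK *\<^sub>v z) i + vec_index (cM *\<^sub>v y) i) * cnj (vec_index y i)) = 0"
      by (intro sum.neutral) (use row1' in auto)
    with car y show ?thesis
      by (simp add: scalar_prod_def atLeast0LessThan distrib_right sum.distrib eq_neg_iff_add_eq_0
          del: index_mult_mat_vec)
  qed
  \<comment> \<open>Hermitian symmetry of \<open>K\<close> carries the first row, paired with
    \<open>y\<close>, over to the \<open>K\<close> term of the second row paired with
    \<open>z\<close>. The conjugate disappears because the form of \<open>M\<close> is real.\<close>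
  have hK': "scalar_prod (cK *\<^sub>v y) (conjugate z) = - complex_of_real (hermitian_form M y)"
    using complex_mult_scalar_prod_swap[OF sym(2) y z] hermitian_form_complex[OF sym(1) y] hK
    by (simp add: cM_def cK_def)
  have "scalar_prod (cM *\<^sub>v z - cK *\<^sub>v y) (conjugate z)
      = \<mu> * scalar_prod (cL *\<^sub>v z - cK *\<^sub>v y) (conjugate z)"
    using row2 car z y by (metis smult_scalar_prod_distrib carrier_vec_conjugate minus_carrier_vec mult_mat_vec_carrier)
  then have eq: "complex_of_real (hermitian_form M z + hermitian_form M y)
      = \<mu> * complex_of_real (hermitian_form L z + hermitian_form M y)"
    using car z y hK' hermitian_form_complex[OF sym(1) z] hermitian_form_complex[OF L z]
    by (simp add: minus_scalar_prod_distrib[of _ n] cM_def cL_def)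
  have "y \<noteq> 0\<^sub>v n"
  proof
    assume y0: "y = 0\<^sub>v n"
    with hermitian_form_pos[OF K z] nz have "0 < hermitian_form K z" by auto
    moreover have "cK *\<^sub>v z = 0\<^sub>v n"
      using row1' car z y0 by (intro eq_vecI) auto
    ultimately show False
      using hermitian_form_complex[OF sym(2) z] z by (simp add: cK_def)
  qed
  then have s: "0 < hermitian_form M y" by (rule hermitian_form_pos[OF M y])
  have b: "C * hermitian_form L z \<le> hermitian_form M z" "hermitian_form M z \<le> hermitian_form L z"
    using equiv[of "map_vec Re z"] equiv[of "map_vec Im z"] z
    by (auto simp: hermitian_form_def distrib_left)
  \<comment> \<open>The two-sided equivalence gives \<open>C l \<le> l\<close> for the form
    \<open>l\<close> of \<open>L\<close>, and \<open>C < 1\<close> then forces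
    \<open>0 \<le> l\<close>.\<close>
  have l: "0 \<le> hermitian_form L z"
  proof -
    have "0 \<le> (1 - C) * hermitian_form L z"
      using order_trans[OF b] by (simp add: left_diff_distrib)
    with C show ?thesis by (simp add: zero_le_mult_iff)
  qed
  have "C * hermitian_form M y < hermitian_form M y" using s C by simp
  with b have "C * (hermitian_form L z + hermitian_form M y) < hermitian_form M z + hermitian_form M y"
    unfolding distrib_left by linarith
  with s b l have "(hermitian_form M z + hermitian_form M y) / (hermitian_form L z + hermitian_form M y) \<in> {C<..1}"
    by (simp add: pos_less_divide_eq)
  moreover have "\<mu> = complex_of_real ((hermitian_form M z + hermitian_form M y) / (hermitian_form L z + hermitian_form M y))"
  proof -
    have "complex_of_real (hermitian_form L z + hermitian_form M y) \<noteq> 0"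
      using s l unfolding of_real_eq_0_iff by linarith
    with eq show ?thesis by (simp add: eq_divide_eq)
  qed
  ultimately show ?thesis by blast
qed

section \<open>Invertibility of the preconditioner and passage to the spectrum\<close>

text \<open>For a kernel vector \<open>(u, v)\<close>, add the first block row paired with
  \<open>v\<close> to the second paired with \<open>u\<close>. The \<open>K\<close> terms cancel by
  symmetry, and a sum of two definite forms is left equal to zero.\<close>

lemma block_det_nonzero:
  assumes M: "positive_form n M" and K: "symmetric_form n K" and L: "positive_form n L"
  shows "det (four_block_mat K M L (- K)) \<noteq> 0"
proof
  assume "det (four_block_mat K M L (- K)) = 0"
  have sym: "symmetric_form n M" "symmetric_form n L"
    using M L by (auto simp: positive_form_def)
  have car: "M \<in> carrier_mat n n" "K \<in> carrier_mat n n" "L \<in> carrier_mat n n" "- K \<in> carrier_mat n n"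
    using symmetric_form_carrier[OF sym(1)] symmetric_form_carrier[OF sym(2)]
      symmetric_form_carrier[OF K] by auto
  have carB: "four_block_mat K M L (- K) \<in> carrier_mat (n + n) (n + n)" using car by auto
  obtain x where x: "x \<in> carrier_vec (n + n)" "x \<noteq> 0\<^sub>v (n + n)"
      "four_block_mat K M L (- K) *\<^sub>v x = 0\<^sub>v (n + n)"
    using \<open>det _ = 0\<close> det_0_iff_vec_prod_zero[OF carB] by auto
  define u v where "u = vec_first x n" and "v = vec_last x n"
  have uv: "u \<in> carrier_vec n" "v \<in> carrier_vec n" "x = u @\<^sub>v v"
    using x(1) by (auto simp: u_def v_def)
  have split: "(K *\<^sub>v u + M *\<^sub>v v) @\<^sub>v (L *\<^sub>v u + - K *\<^sub>v v) = 0\<^sub>v n @\<^sub>v 0\<^sub>v n"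
  proof -
    have "0\<^sub>v n @\<^sub>v 0\<^sub>v n = (0\<^sub>v (n + n) :: real Matrix.vec)" by (rule eq_vecI) auto
    with x(3) show ?thesis
      unfolding uv(3) four_block_mat_mult_vec[OF car(2,1,3,4) uv(1,2)] by (simp only:)
  qed
  have rows: "K *\<^sub>v u + M *\<^sub>v v = 0\<^sub>v n" "L *\<^sub>v u + - K *\<^sub>v v = 0\<^sub>v n"
    using split car uv by (auto simp: append_vec_eq[of _ n])
  have "scalar_prod (K *\<^sub>v u) v + scalar_prod (M *\<^sub>v v) v = 0"
    using arg_cong[OF rows(1), of "\<lambda>w. scalar_prod w v"] car uv
    by (simp add: add_scalar_prod_distrib[of _ n])
  moreover have "scalar_prod (L *\<^sub>v u) u - scalar_prod (K *\<^sub>v v) u = 0"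
    using arg_cong[OF rows(2), of "\<lambda>w. scalar_prod w u"] car uv
    by (simp add: add_scalar_prod_distrib[of _ n])
  ultimately have sum: "scalar_prod (M *\<^sub>v v) v + scalar_prod (L *\<^sub>v u) u = 0"
    using symmetric_form_swap[OF K uv(1,2)] by simp
  have "0 \<le> scalar_prod (M *\<^sub>v v) v" "v \<noteq> 0\<^sub>v n \<Longrightarrow> 0 < scalar_prod (M *\<^sub>v v) v"
    "0 \<le> scalar_prod (L *\<^sub>v u) u" "u \<noteq> 0\<^sub>v n \<Longrightarrow> 0 < scalar_prod (L *\<^sub>v u) u"
    using M L uv car
    by (cases "v = 0\<^sub>v n"; cases "u = 0\<^sub>v n"; auto simp: positive_form_def less_imp_le)+
  with sum have "u = 0\<^sub>v n" "v = 0\<^sub>v n" by (fastforce, fastforce)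
  with x(2) uv(3) show False by auto
qed

lemma mat_inverse_det_nonzero:
  fixes B :: "'a::field mat"
  assumes B: "B \<in> carrier_mat n n" and "det B \<noteq> 0"
  shows "invertible_mat B"
    and "the (mat_inverse B) \<in> carrier_mat n n" and "B * the (mat_inverse B) = 1\<^sub>m n"
proof -
  have "mat_inverse B \<noteq> None"
    \<comment> \<open>The unit \<open>()\<close> fills the extension slot of the matrix ring record,
      so that both facts speak of the same group of units.\<close>
    using mat_inverse(1)[OF B, where b = "()"] det_non_zero_imp_unit[OF assms, where b = "()"] by blast
  then obtain B' where "mat_inverse B = Some B'" by auto
  with mat_inverse(2)[OF B this] B
  show "invertible_mat B" "the (mat_inverse B) \<in> carrier_mat n n" "B * the (mat_inverse B) = 1\<^sub>m n"
    by (auto simp: invertible_mat_def inverts_mat_def intro!: exI[of _ B'])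
qed

lemma block_preconditioner:
  assumes M: "positive_form n M" and K: "positive_form n K" and L: "symmetric_form n L"
    and C: "0 < C" "C < 1"
    and equiv: "\<And>w. w \<in> carrier_vec n \<Longrightarrow>
        C * scalar_prod (L *\<^sub>v w) w \<le> scalar_prod (M *\<^sub>v w) w \<and>
        scalar_prod (M *\<^sub>v w) w \<le> scalar_prod (L *\<^sub>v w) w"
  defines "\<A> \<equiv> four_block_mat K M M (- K)" and "\<B> \<equiv> four_block_mat K M L (- K)"
  shows "invertible_mat \<B>"
    and "spectrum (map_mat complex_of_real (the (mat_inverse \<B>) * \<A>)) \<subseteq> complex_of_real ` {C<..1}"
proof -
  \<comment> \<open>The form of \<open>L\<close> dominates the positive form of
    \<open>M\<close>.\<close>
  have L': "positive_form n L"
    using L M equiv unfolding positive_form_def by (meson less_le_trans)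
  have sym: "symmetric_form n M" "symmetric_form n K"
    using M K by (auto simp: positive_form_def)
  have car: "M \<in> carrier_mat n n" "K \<in> carrier_mat n n" "L \<in> carrier_mat n n" "- K \<in> carrier_mat n n"
    using symmetric_form_carrier[OF sym(1)] symmetric_form_carrier[OF sym(2)]
      symmetric_form_carrier[OF L] by auto
  have carA: "\<A> \<in> carrier_mat (n + n) (n + n)" and carB: "\<B> \<in> carrier_mat (n + n) (n + n)"
    using car by (auto simp: \<A>_def \<B>_def)
  note inv = mat_inverse_det_nonzero[OF carB block_det_nonzero[OF M sym(2) L', folded \<B>_def]]
  show "invertible_mat \<B>" by (rule inv)
  show "spectrum (map_mat complex_of_real (the (mat_inverse \<B>) * \<A>)) \<subseteq> complex_of_real ` {C<..1}"
  proof
    fix \<mu>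
    assume "\<mu> \<in> spectrum (map_mat complex_of_real (the (mat_inverse \<B>) * \<A>))"
    then obtain x where x: "x \<in> carrier_vec (n + n)" "x \<noteq> 0\<^sub>v (n + n)"
        "map_mat complex_of_real (the (mat_inverse \<B>) * \<A>) *\<^sub>v x = \<mu> \<cdot>\<^sub>v x"
      using carA inv(2) by (auto simp: spectrum_def eigenvalue_def eigenvector_def)
    let ?c = "map_mat complex_of_real"
    let ?X = "the (mat_inverse \<B>) * \<A>"
    have X: "?X \<in> carrier_mat (n + n) (n + n)" using carA inv(2) by auto
    \<comment> \<open>Multiplying the eigenvalue equation of \<open>?X\<close> by
      \<open>\<B>\<close> removes the inverse and yields the pencil equation
      \<open>\<A> x = \<mu> \<B> x\<close>.\<close>
    have "\<A> = \<B> * ?X"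
      using carA carB inv(2,3) by (simp flip: assoc_mult_mat)
    then have "?c \<A> = ?c \<B> * ?c ?X"
      by (subst of_real_hom.mat_hom_mult[OF carB X, symmetric]) (rule arg_cong)
    moreover have "(?c \<B> * ?c ?X) *\<^sub>v x = ?c \<B> *\<^sub>v (?c ?X *\<^sub>v x)"
      using carB X x(1) by (intro assoc_mult_mat_vec) auto
    ultimately have "?c \<A> *\<^sub>v x = ?c \<B> *\<^sub>v (?c ?X *\<^sub>v x)"
      by (simp only:)
    then have eq: "?c \<A> *\<^sub>v x = \<mu> \<cdot>\<^sub>v (?c \<B> *\<^sub>v x)"
      unfolding x(3) using carB x(1) by (subst (asm) mult_mat_vec[of _ "n + n" "n + n"]) auto
    define z y where "z = vec_first x n" and "y = vec_last x n"
    have zy: "z \<in> carrier_vec n" "y \<in> carrier_vec n" "x = z @\<^sub>v y"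
      using x(1) by (auto simp: z_def y_def)
    have neg: "?c (- K) *\<^sub>v y = - (?c K *\<^sub>v y)"
    proof -
      have "?c (- K) = - ?c K" by (rule eq_matI) auto
      with car zy show ?thesis by simp
    qed
    have ccar: "?c M \<in> carrier_mat n n" "?c K \<in> carrier_mat n n" "?c L \<in> carrier_mat n n"
      "?c (- K) \<in> carrier_mat n n" using car by auto
    have split: "(?c K *\<^sub>v z + ?c M *\<^sub>v y) @\<^sub>v (?c M *\<^sub>v z - ?c K *\<^sub>v y) =
      (\<mu> \<cdot>\<^sub>v (?c K *\<^sub>v z + ?c M *\<^sub>v y)) @\<^sub>v (\<mu> \<cdot>\<^sub>v (?c L *\<^sub>v z - ?c K *\<^sub>v y))"
    proof -
      have smult: "\<mu> \<cdot>\<^sub>v (a @\<^sub>v b) = (\<mu> \<cdot>\<^sub>v a) @\<^sub>v (\<mu> \<cdot>\<^sub>v b)" for a b :: "complex Matrix.vec"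
        by (rule eq_vecI) auto
      have uminus: "a + - b = a - b" if "a \<in> carrier_vec n" "b \<in> carrier_vec n" for a b :: "complex Matrix.vec"
        using that by (intro eq_vecI) auto
      show ?thesis
        using eq ccar zy neg
        unfolding zy(3) \<A>_def \<B>_def map_four_block_mat[OF car(2,1,1,4)] map_four_block_mat[OF car(2,1,3,4)]
          four_block_mat_mult_vec[OF ccar(2,1,1,4) zy(1,2)] four_block_mat_mult_vec[OF ccar(2,1,3,4) zy(1,2)]
        by (simp add: smult uminus)
    qed
    show "\<mu> \<in> complex_of_real ` {C<..1}"
    proof (rule pencil_eigenvalue[OF M K L C equiv zy(1,2)])
      show "z \<noteq> 0\<^sub>v n \<or> y \<noteq> 0\<^sub>v n" using x(2) zy(3) by auto
    qed (use split ccar zy in \<open>auto simp: append_vec_eq[of _ n]\<close>)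
  qed
qed

section \<open>Gram matrices and finite element functions\<close>

text \<open>Linearity moves the quadratic form under the integral sign. Mass and stiffness matrices
  both have this shape, with \<open>F i j\<close> the pointwise pairing of basis functions or of
  their gradients.\<close>

lemma gram_form:
  fixes F :: "nat \<Rightarrow> nat \<Rightarrow> 'x \<Rightarrow> real"
  assumes int: "\<And>i j. i < n \<Longrightarrow> j < n \<Longrightarrow> integrable N (F i j)" and w: "w \<in> carrier_vec n"
  shows "integrable N (\<lambda>x. \<Sum>i<n. \<Sum>j<n. F i j x * vec_index w j * vec_index w i)"
    and "scalar_prod (Matrix.mat n n (\<lambda>(i, j). LINT x|N. F i j x) *\<^sub>v w) w =
      (LINT x|N. (\<Sum>i<n. \<Sum>j<n. F i j x * vec_index w j * vec_index w i))"
proof -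
  let ?f = "\<lambda>x. \<Sum>i<n. \<Sum>j<n. F i j x * vec_index w j * vec_index w i"
  show "integrable N ?f"
    by (intro Bochner_Integration.integrable_sum integrable_mult_left) (auto intro: int)
  have "(LINT x|N. ?f x) = (\<Sum>i<n. LINT x|N. (\<Sum>j<n. F i j x * vec_index w j * vec_index w i))"
    by (rule Bochner_Integration.integral_sum)
      (auto intro!: Bochner_Integration.integrable_sum integrable_mult_left int)
  also have "\<dots> = (\<Sum>i<n. \<Sum>j<n. LINT x|N. F i j x * vec_index w j * vec_index w i)"
    by (intro sum.cong refl Bochner_Integration.integral_sum)
      (auto intro!: Bochner_Integration.integrable_sum integrable_mult_left int)
  also have "\<dots> = (\<Sum>i<n. \<Sum>j<n. (LINT x|N. F i j x) * vec_index w j * vec_index w i)"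
    by simp
  finally show "scalar_prod (Matrix.mat n n (\<lambda>(i, j). LINT x|N. F i j x) *\<^sub>v w) w = (LINT x|N. ?f x)"
    using w by (simp add: mult_scalar_prod_sum[where n = n])
qed

text \<open>A nonnegative integrand with integral zero vanishes almost everywhere, so definiteness
  is reduced to the pointwise condition \<open>definite\<close>.\<close>

lemma gram_positive_form:
  fixes F :: "nat \<Rightarrow> nat \<Rightarrow> 'x \<Rightarrow> real"
  assumes int: "\<And>i j. i < n \<Longrightarrow> j < n \<Longrightarrow> integrable N (F i j)"
    and sym: "\<And>i j x. i < n \<Longrightarrow> j < n \<Longrightarrow> x \<in> space N \<Longrightarrow> F i j x = F j i x"
    and nonneg: "\<And>w x. w \<in> carrier_vec n \<Longrightarrow> x \<in> space N \<Longrightarrow>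
        0 \<le> (\<Sum>i<n. \<Sum>j<n. F i j x * vec_index w j * vec_index w i)"
    and definite: "\<And>w. w \<in> carrier_vec n \<Longrightarrow>
        AE x in N. (\<Sum>i<n. \<Sum>j<n. F i j x * vec_index w j * vec_index w i) = 0 \<Longrightarrow> w = 0\<^sub>v n"
  shows "positive_form n (Matrix.mat n n (\<lambda>(i, j). LINT x|N. F i j x))"
proof -
  have "(LINT x|N. F i j x) = (LINT x|N. F j i x)" if "i < n" "j < n" for i j
    using sym that by (intro Bochner_Integration.integral_cong) auto
  moreover have "0 < scalar_prod (Matrix.mat n n (\<lambda>(i, j). LINT x|N. F i j x) *\<^sub>v w) w"
    if w: "w \<in> carrier_vec n" "w \<noteq> 0\<^sub>v n" for w
  proof -
    let ?f = "\<lambda>x. \<Sum>i<n. \<Sum>j<n. F i j x * vec_index w j * vec_index w i"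
    note gram = gram_form[OF int w(1)]
    have "0 \<le> (LINT x|N. ?f x)" using nonneg w by (intro Bochner_Integration.integral_nonneg) auto
    moreover have "(LINT x|N. ?f x) \<noteq> 0"
      using integral_nonneg_eq_0_iff_AE[OF gram(1)] nonneg[OF w(1)] definite[OF w(1)] w(2) by auto
    ultimately show ?thesis using gram(2) by simp
  qed
  ultimately show ?thesis by (auto simp: positive_form_def symmetric_form_def)
qed

section \<open>Almost everywhere arguments, gradients and coefficients\<close>

text \<open>A nonempty open set is not negligible, so it cannot lie inside the exceptional null
  set.\<close>

lemma AE_lebesgue_on_obtain_open:
  fixes \<Omega> V :: "'e::euclidean_space set"
  assumes "AE x in lebesgue_on \<Omega>. P x" "open \<Omega>" "open V" "V \<inter> \<Omega> \<noteq> {}"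
  obtains x where "x \<in> V" "x \<in> \<Omega>" "P x"
proof -
  have "AE x in lebesgue. x \<in> \<Omega> \<longrightarrow> P x"
    using assms(1,2) by (subst (asm) AE_restrict_space_iff) auto
  then obtain N where N: "N \<in> null_sets lebesgue" "{x. \<not> (x \<in> \<Omega> \<longrightarrow> P x)} \<subseteq> N"
    by (auto simp: eventually_ae_filter)
  have "\<not> V \<inter> \<Omega> \<subseteq> N"
    using N(1) assms open_not_negligible[of "V \<inter> \<Omega>"] negligible_subset
    by (auto simp: negligible_iff_null_sets[symmetric] open_Int)
  then show ?thesis using N(2) that by blast
qed

text \<open>This is completeness of Lebesgue measure, transferred to \<open>S\<close> by extending
  both functions by zero. It serves to ignore gradients on the cell boundaries.\<close>

lemma borel_measurable_lebesgue_on_AE: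
  fixes f g :: "'e::euclidean_space \<Rightarrow> real"
  assumes "f \<in> borel_measurable (lebesgue_on S)" "AE x in lebesgue_on S. f x = g x" "S \<in> sets lebesgue"
  shows "g \<in> borel_measurable (lebesgue_on S)"
proof -
  have "AE x in lebesgue. (if x \<in> S then f x else 0) = (if x \<in> S then g x else 0)"
    using assms(2,3) by (subst (asm) AE_restrict_space_iff) (auto elim: eventually_mono)
  then have "(\<lambda>x. if x \<in> S then g x else 0) \<in> borel_measurable lebesgue"
    by (rule borel_measurable_AE[rotated]) (use assms(1,3) in \<open>simp add: borel_measurable_if\<close>)
  with assms(3) show ?thesis by (simp add: borel_measurable_if)
qed

text \<open>Uniqueness of the derivative settles the definite description in
  \<open>grad\<close>.\<close>

lemma grad_eqI: "grad u x = D" if "GDERIV u x :> D"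
  unfolding grad_def
proof (rule the_equality[where a = D])
  show "GDERIV u x :> D" by (rule that)
next
  fix D'
  assume "GDERIV u x :> D'"
  then have "(\<lambda>h. inner h D') = (\<lambda>h. inner h D)"
    using that unfolding gderiv_def by (rule has_derivative_unique)
  then have "inner h D' = inner h D" for h by metis
  then show "D' = D" using vector_eq_ldot by blast
qed

lemma grad_affine:
  assumes "\<And>y. y \<in> K \<Longrightarrow> u y = inner g y + c" "x \<in> interior K"
  shows "grad u x = g"
proof (rule grad_eqI)
  have "((\<lambda>y. inner g y + c) has_derivative (\<lambda>h. inner h g)) (at x)"
    by (auto intro!: derivative_eq_intros simp: inner_commute)
  then show "GDERIV u x :> g"
    unfolding gderiv_def
    by (rule has_derivative_transform_within_open[OF _ open_interior assms(2)])
      (use assms(1) interior_subset in \<open>metis subsetD\<close>)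
qed

lemma coefficient_inner_commute:
  assumes "diffusion_coefficient \<Omega> a" "x \<in> \<Omega>"
  shows "inner (a x *v v) w = inner (a x *v w) v"
proof -
  have "transpose (a x) = a x" using assms by (simp add: diffusion_coefficient_def)
  then have "a x *v v = v v* a x" by (metis transpose_matrix_vector)
  then have "inner (a x *v v) w = inner v (a x *v w)" by (simp only: dot_lmul_matrix)
  then show ?thesis by (simp only: inner_commute)
qed

lemma coefficient_bounds:
  assumes "diffusion_coefficient \<Omega> a"
  obtains c C where "0 < c" "\<And>x v. x \<in> \<Omega> \<Longrightarrow> c * (norm v)\<^sup>2 \<le> inner (a x *v v) v"
    "\<And>x v. x \<in> \<Omega> \<Longrightarrow> inner (a x *v v) v \<le> C * (norm v)\<^sup>2"
proof -
  obtain lam Lam c C where "\<forall>x\<in>\<Omega>. \<forall>\<xi>. lam x * (norm \<xi>)\<^sup>2 \<le> inner \<xi> (a x *v \<xi>) \<and> inner \<xi> (a x *v \<xi>) \<le> Lam x * (norm \<xi>)\<^sup>2"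
    and "0 < c" "\<forall>x\<in>\<Omega>. c \<le> lam x" "\<forall>x\<in>\<Omega>. Lam x \<le> C"
    using assms unfolding diffusion_coefficient_def by blast
  then have "c * (norm v)\<^sup>2 \<le> inner (a x *v v) v \<and> inner (a x *v v) v \<le> C * (norm v)\<^sup>2" if "x \<in> \<Omega>" for x v
    using that mult_right_mono[of c "lam x" "(norm v)\<^sup>2"] mult_right_mono[of "Lam x" C "(norm v)\<^sup>2"]
    by (fastforce simp: inner_commute intro: order_trans)
  with \<open>0 < c\<close> show ?thesis using that by blast
qed

text \<open>Polarization, so that the bound on the quadratic form controls all entries.\<close>

lemma coefficient_inner_bounded:
  assumes a: "diffusion_coefficient \<Omega> a"
  obtains C where "\<And>x v w. x \<in> \<Omega> \<Longrightarrow> \<bar>inner (a x *v v) w\<bar> \<le> C * ((norm v)\<^sup>2 + (norm w)\<^sup>2)"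
proof -
  obtain c C where c: "0 < c" and lower: "\<And>x v. x \<in> \<Omega> \<Longrightarrow> c * (norm v)\<^sup>2 \<le> inner (a x *v v) v"
    and upper: "\<And>x v. x \<in> \<Omega> \<Longrightarrow> inner (a x *v v) v \<le> C * (norm v)\<^sup>2"
    using coefficient_bounds[OF a] by blast
  have "\<bar>inner (a x *v v) w\<bar> \<le> C / 2 * ((norm v)\<^sup>2 + (norm w)\<^sup>2)" if x: "x \<in> \<Omega>" for x v w
  proof -
    let ?q = "\<lambda>v. inner (a x *v v) v"
    have nonneg: "0 \<le> ?q v" for v
      using lower[OF x, of v] c by (meson order_trans mult_nonneg_nonneg less_imp_le zero_le_power2)
    have swap: "inner (a x *v w) v = inner (a x *v v) w"
      by (rule coefficient_inner_commute[OF a x])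
    have plus: "?q (v + w) = ?q v + 2 * inner (a x *v v) w + ?q w"
      and minus: "?q (v - w) = ?q v - 2 * inner (a x *v v) w + ?q w"
      by (simp_all add: matrix_vector_right_distrib matrix_vector_mult_diff_distrib
          inner_add_left inner_add_right inner_diff_left inner_diff_right swap)
    \<comment> \<open>Nonnegativity of \<open>?q (v + w)\<close> and \<open>?q (v - w)\<close>
      bounds twice the mixed term, in absolute value, by \<open>?q v + ?q w\<close>; hence the
      constant \<open>C / 2\<close>.\<close>
    show ?thesis
      using nonneg[of "v + w"] nonneg[of "v - w"] upper[OF x, of v] upper[OF x, of w]
      unfolding plus minus by (simp add: distrib_left abs_le_iff)
  qed
  then show ?thesis by (rule that)
qed

text \<open>The product \<open>*v\<close> is jointly continuous in the matrix and the
  vector.\<close>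

lemma borel_measurable_coefficient_inner:
  fixes a :: "'x \<Rightarrow> real ^ 'd ^ 'd"
  assumes "a \<in> borel_measurable N" "g \<in> borel_measurable N" "h \<in> borel_measurable N"
  shows "(\<lambda>x. inner (a x *v g x) (h x)) \<in> borel_measurable N"
proof -
  have "continuous_on UNIV (\<lambda>p :: (real ^ 'd ^ 'd) \<times> (real ^ 'd). fst p *v snd p)"
    unfolding matrix_vector_mult_def by (intro continuous_intros)
  from borel_measurable_continuous_Pair[OF assms(1,2) this] assms(3) show ?thesis
    by (rule borel_measurable_inner)
qed

section \<open>Cells and finite element functions on one mesh\<close>

locale fe_mesh =
  fixes \<Omega> :: "(real ^ 'd) set" and \<T> :: "(real ^ 'd) set set"
  assumes polyhedral: "polyhedral_domain \<Omega>" and mesh: "mesh \<Omega> \<T>"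
begin

lemma domain: "open \<Omega>" "connected \<Omega>" "\<Omega> \<noteq> {}" "bounded \<Omega>"
  using polyhedral by (auto simp: polyhedral_domain_def)

lemma domain_sets: "\<Omega> \<in> sets lebesgue" "space (lebesgue_on \<Omega>) = \<Omega>"
  using domain by auto

lemma finite_measure_domain: "finite_measure (lebesgue_on \<Omega>)"
  using domain by (simp add: finite_measure_lebesgue_on lmeasurable_open)

lemma finite_mesh: "finite \<T>" and Union_mesh: "\<Union>\<T> = closure \<Omega>"
  using mesh by (auto simp: mesh_def triangulation_def)

lemma convex_cell: "K \<in> \<T> \<Longrightarrow> convex K" and closed_cell: "K \<in> \<T> \<Longrightarrow> closed K"
  using mesh by (auto simp: mesh_def intro: convex_simplex closed_simplex)

text \<open>A simplex of full dimension has the whole space as affine hull, so its nonempty relative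
  interior is its interior. An open nonempty subset of the closure of \<Omega> must meet
  \<Omega>.\<close>

lemma interior_cell_nonempty:
  assumes "K \<in> \<T>" shows "interior K \<inter> \<Omega> \<noteq> {}"
proof -
  have dim: "aff_dim K = int DIM(real ^ 'd)"
    using mesh assms aff_dim_simplex by (fastforce simp: mesh_def)
  then have "K \<noteq> {}" by auto
  moreover have "affine hull K = UNIV" using dim aff_dim_eq_full by blast
  ultimately have "interior K \<noteq> {}"
    using rel_interior_eq_empty[OF convex_cell[OF assms]] rel_interior_interior[of K]
    by simp
  moreover have "interior K \<subseteq> closure \<Omega>"
    using assms Union_mesh interior_subset by blast
  ultimately show ?thesis
    using open_Int_closure_eq_empty[of "interior K" \<Omega>] by auto
qed

text \<open>An open set on which every finite element function is locally affine, so that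
  \<open>grad\<close> is its true gradient there.\<close>

definition cell_interiors :: "(real ^ 'd) set" where
  "cell_interiors = (\<Union>K\<in>\<T>. interior K)"

text \<open>Frontiers of convex sets are negligible, and there are finitely many cells.\<close>

lemma AE_cell_interiors: "AE x in lebesgue_on \<Omega>. x \<in> cell_interiors"
proof -
  have "negligible (\<Union>K\<in>\<T>. frontier K)"
    using finite_mesh convex_cell by (auto intro!: negligible_Union negligible_convex_frontier)
  then have "AE x in lebesgue. x \<notin> (\<Union>K\<in>\<T>. frontier K)"
    unfolding negligible_iff_null_sets by (rule AE_not_in)
  then have "AE x in lebesgue. x \<in> \<Omega> \<longrightarrow> x \<in> cell_interiors"
  proof eventually_elim
    case (elim x)
    show ?case
    proof
      assume "x \<in> \<Omega>"
      then obtain K where "K \<in> \<T>" "x \<in> K" using Union_mesh closure_subset by blast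
      with elim closed_cell show "x \<in> cell_interiors"
        by (auto simp: cell_interiors_def frontier_def)
    qed
  qed
  then show ?thesis using domain_sets by (subst AE_restrict_space_iff) auto
qed

lemma fe_space_affine:
  assumes "u \<in> fe_space \<Omega> \<T>" "K \<in> \<T>"
  obtains g c where "\<And>x. x \<in> K \<Longrightarrow> u x = inner g x + c"
  using assms by (fastforce simp: fe_space_def)

lemma fe_space_sum:
  assumes "\<And>i. i < n \<Longrightarrow> f i \<in> fe_space \<Omega> \<T>"
  shows "(\<lambda>x. \<Sum>i<n. r i * f i x) \<in> fe_space \<Omega> \<T>"
proof -
  have "\<exists>g c. \<forall>x\<in>K. (\<Sum>i<n. r i * f i x) = inner g x + c" if K: "K \<in> \<T>" for K
  proof -
    have "\<forall>i\<in>{..<n}. \<exists>g c. \<forall>x\<in>K. f i x = inner g x + c"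
      using assms K by (auto simp: fe_space_def)
    then obtain g c where "\<And>i x. i < n \<Longrightarrow> x \<in> K \<Longrightarrow> f i x = inner (g i) x + c i"
      by (metis lessThan_iff)
    then have "(\<Sum>i<n. r i * f i x) = inner (\<Sum>i<n. r i *\<^sub>R g i) x + (\<Sum>i<n. r i * c i)" if "x \<in> K" for x
      using that by (simp add: inner_sum_left distrib_left sum.distrib)
    then show ?thesis by blast
  qed
  moreover have "continuous_on (closure \<Omega>) (\<lambda>x. \<Sum>i<n. r i * f i x)"
    using assms by (intro continuous_intros) (auto simp: fe_space_def)
  moreover have "(\<Sum>i<n. r i * f i x) = 0" if "x \<notin> \<Omega>" for x
    using assms that by (auto simp: fe_space_def intro!: sum.neutral)
  ultimately show ?thesis by (auto simp: fe_space_def)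
qed

text \<open>Inside a cell all summands are affine, so the slopes can be combined directly.\<close>

lemma grad_sum:
  assumes f: "\<And>i. i < n \<Longrightarrow> f i \<in> fe_space \<Omega> \<T>" and x: "x \<in> cell_interiors"
  shows "grad (\<lambda>x. \<Sum>i<n. r i * f i x) x = (\<Sum>i<n. r i *\<^sub>R grad (f i) x)"
proof -
  obtain K where K: "K \<in> \<T>" "x \<in> interior K" using x by (auto simp: cell_interiors_def)
  have "\<forall>i\<in>{..<n}. \<exists>g c. \<forall>x\<in>K. f i x = inner g x + c"
    using f K by (auto simp: fe_space_def)
  then obtain g c where gc: "\<And>i x. i < n \<Longrightarrow> x \<in> K \<Longrightarrow> f i x = inner (g i) x + c i"
    by (metis lessThan_iff)
  have "grad (\<lambda>x. \<Sum>i<n. r i * f i x) x = (\<Sum>i<n. r i *\<^sub>R g i)"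
    by (rule grad_affine[OF _ K(2), of _ _ "\<Sum>i<n. r i * c i"])
      (simp add: gc inner_sum_left distrib_left sum.distrib)
  moreover have "grad (f i) x = g i" if "i < n" for i
    using gc[OF that] by (rule grad_affine[OF _ K(2)])
  ultimately show ?thesis by simp
qed

text \<open>The gradient has a single value on each open cell. It is therefore continuous on their
  union, and finiteness of the mesh bounds it.\<close>

lemma grad_piecewise_constant:
  assumes u: "u \<in> fe_space \<Omega> \<T>"
  shows "(\<lambda>x. indicator cell_interiors x *\<^sub>R grad u x) \<in> borel_measurable borel"
    and "\<exists>B. \<forall>x\<in>cell_interiors. (norm (grad u x))\<^sup>2 \<le> B"
proof -
  have "\<forall>K\<in>\<T>. \<exists>g. \<forall>x\<in>interior K. grad u x = g"
    using fe_space_affine[OF u] grad_affine by metis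
  then obtain g where g: "\<And>K x. K \<in> \<T> \<Longrightarrow> x \<in> interior K \<Longrightarrow> grad u x = g K"
    by metis
  have "continuous_on (interior K) (grad u)" if "K \<in> \<T>" for K
    using continuous_on_cong[of "interior K" "interior K" "grad u" "\<lambda>_. g K"] g[OF that] by simp
  then have "continuous_on cell_interiors (grad u)"
    unfolding cell_interiors_def by (intro continuous_on_open_UN) auto
  then show "(\<lambda>x. indicator cell_interiors x *\<^sub>R grad u x) \<in> borel_measurable borel"
    by (intro borel_measurable_continuous_on_indicator) (auto simp: cell_interiors_def intro!: borel_open)
  \<comment> \<open>The sum over all cells dominates the value on any one of them.\<close>
  have "(norm (grad u x))\<^sup>2 \<le> (\<Sum>K\<in>\<T>. (norm (g K))\<^sup>2)" if "x \<in> cell_interiors" for x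
    using that g finite_mesh by (auto simp: cell_interiors_def intro!: member_le_sum[where f = "\<lambda>K. (norm (g K))\<^sup>2"])
  then show "\<exists>B. \<forall>x\<in>cell_interiors. (norm (grad u x))\<^sup>2 \<le> B" by blast
qed

text \<open>An almost everywhere bounded measurable function on a set of finite measure is
  integrable.\<close>

lemma integrable_stiffness:
  assumes a: "diffusion_coefficient \<Omega> a" and u: "u \<in> fe_space \<Omega> \<T>" and v: "v \<in> fe_space \<Omega> \<T>"
  shows "integrable (lebesgue_on \<Omega>) (\<lambda>x. inner (a x *v grad u x) (grad v x))"
proof -
  interpret finite_measure "lebesgue_on \<Omega>" by (rule finite_measure_domain)
  let ?G = "\<lambda>u x. indicator cell_interiors x *\<^sub>R grad u x"
  have meas: "?G u \<in> borel_measurable (lebesgue_on \<Omega>)" if "u \<in> fe_space \<Omega> \<T>" for u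
    using grad_piecewise_constant(1)[OF that] by (simp add: measurable_completion measurable_restrict_space1)
  \<comment> \<open>Measurability is shown first for the gradients cut off to zero outside the open
    cells, then transferred along almost everywhere equality.\<close>
  have "(\<lambda>x. inner (a x *v ?G u x) (?G v x)) \<in> borel_measurable (lebesgue_on \<Omega>)"
    using a by (intro borel_measurable_coefficient_inner meas u v) (simp add: diffusion_coefficient_def)
  then have "(\<lambda>x. inner (a x *v grad u x) (grad v x)) \<in> borel_measurable (lebesgue_on \<Omega>)"
    by (rule borel_measurable_lebesgue_on_AE)
      (use AE_cell_interiors domain_sets in \<open>auto elim: eventually_mono\<close>)
  moreover obtain C where C: "\<And>x v w. x \<in> \<Omega> \<Longrightarrow> \<bar>inner (a x *v v) w\<bar> \<le> C * ((norm v)\<^sup>2 + (norm w)\<^sup>2)"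
    using coefficient_inner_bounded[OF a] by blast
  obtain B where B: "\<And>x. x \<in> cell_interiors \<Longrightarrow> (norm (grad u x))\<^sup>2 \<le> B"
    using grad_piecewise_constant(2)[OF u] by blast
  obtain B' where B': "\<And>x. x \<in> cell_interiors \<Longrightarrow> (norm (grad v x))\<^sup>2 \<le> B'"
    using grad_piecewise_constant(2)[OF v] by blast
  have "norm (inner (a x *v grad u x) (grad v x)) \<le> \<bar>C\<bar> * (B + B')" if "x \<in> \<Omega>" "x \<in> cell_interiors" for x
  proof -
    let ?s = "(norm (grad u x))\<^sup>2 + (norm (grad v x))\<^sup>2"
    have "norm (inner (a x *v grad u x) (grad v x)) \<le> C * ?s"
      using C[OF that(1)] by simp
    \<comment> \<open>The obtained constant \<open>C\<close> comes without a sign, while the next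
      estimate multiplies by a nonnegative factor.\<close>
    also have "\<dots> \<le> \<bar>C\<bar> * ?s" by (intro mult_right_mono) auto
    also have "\<dots> \<le> \<bar>C\<bar> * (B + B')" using B[OF that(2)] B'[OF that(2)] by (intro mult_left_mono) auto
    finally show ?thesis .
  qed
  note bound = this
  have "AE x in lebesgue_on \<Omega>. norm (inner (a x *v grad u x) (grad v x)) \<le> \<bar>C\<bar> * (B + B')"
    using AE_cell_interiors AE_space[of "lebesgue_on \<Omega>"]
    by eventually_elim (rule bound, simp_all add: domain_sets)
  ultimately show ?thesis by (intro integrable_const_bound)
qed

lemma integrable_mass:
  assumes u: "u \<in> fe_space \<Omega> \<T>" and v: "v \<in> fe_space \<Omega> \<T>"
  shows "integrable (lebesgue_on \<Omega>) (\<lambda>x. u x * v x)"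
proof -
  interpret finite_measure "lebesgue_on \<Omega>" by (rule finite_measure_domain)
  have cont: "continuous_on (closure \<Omega>) (\<lambda>x. u x * v x)"
    using u v by (auto simp: fe_space_def intro: continuous_intros)
  then have "(\<lambda>x. u x * v x) \<in> borel_measurable (lebesgue_on \<Omega>)"
    using domain_sets(1) continuous_on_subset[OF _ closure_subset]
    by (intro continuous_imp_measurable_on_sets_lebesgue) auto
  moreover have "bounded ((\<lambda>x. u x * v x) ` closure \<Omega>)"
    using domain cont by (intro compact_imp_bounded compact_continuous_image) auto
  then obtain B where "\<And>x. x \<in> closure \<Omega> \<Longrightarrow> norm (u x * v x) \<le> B"
    by (auto simp: bounded_iff)
  then have "AE x in lebesgue_on \<Omega>. norm (u x * v x) \<le> B"
    using closure_subset[of \<Omega>] domain_sets(2) by (intro AE_I2) blast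
  ultimately show ?thesis by (intro integrable_const_bound)
qed

text \<open>A finite element function with vanishing gradient takes finitely many values on the
  connected closure of the domain, and the value on the frontier is zero.\<close>

lemma fe_space_grad_zero:
  assumes u: "u \<in> fe_space \<Omega> \<T>" and "AE x in lebesgue_on \<Omega>. grad u x = 0"
  shows "u x = 0"
proof -
  have "\<exists>c. \<forall>x\<in>K. u x = c" if K: "K \<in> \<T>" for K
  proof -
    obtain g c where gc: "\<And>x. x \<in> K \<Longrightarrow> u x = inner g x + c"
      using fe_space_affine[OF u K] by blast
    obtain y where "y \<in> interior K" "grad u y = 0"
      \<comment> \<open>The slope is constant on the cell, so one interior point with zero gradient
        is enough.\<close>
      using AE_lebesgue_on_obtain_open[OF assms(2) domain(1) open_interior interior_cell_nonempty[OF K]]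
      by blast
    with grad_affine[OF gc] have "g = 0" by metis
    with gc show ?thesis by auto
  qed
  then obtain c where c: "\<And>K x. K \<in> \<T> \<Longrightarrow> x \<in> K \<Longrightarrow> u x = c K" by metis
  then have "u ` closure \<Omega> \<subseteq> c ` \<T>" unfolding Union_mesh[symmetric] by blast
  then have "finite (u ` closure \<Omega>)" using finite_mesh finite_subset by blast
  then have "u constant_on closure \<Omega>"
    using u domain by (intro continuous_finite_range_constant connected_imp_connected_closure) (auto simp: fe_space_def)
  then obtain k where k: "\<And>y. y \<in> closure \<Omega> \<Longrightarrow> u y = k" by (auto simp: constant_on_def)
  have out: "u y = 0" if "y \<notin> \<Omega>" for y using u that by (auto simp: fe_space_def)
  have "frontier \<Omega> \<noteq> {}"
    using domain not_bounded_UNIV by (intro frontier_not_empty) auto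
  then obtain y where "y \<in> closure \<Omega>" "y \<notin> \<Omega>"
    using domain(1) by (auto simp: frontier_def interior_open)
  with k out have "k = 0" by metis
  with k out closure_subset show ?thesis by blast
qed

section \<open>Definiteness of the mass and stiffness matrices\<close>

text \<open>Evaluation at the \<open>j\<close>-th node, a point of \<Omega>, isolates the
  \<open>j\<close>-th coefficient. Both definiteness proofs end here.\<close>

lemma nodal_coefficients_zero:
  assumes \<phi>: "nodal_basis \<Omega> \<T> \<phi>" and w: "w \<in> carrier_vec (length \<phi>)"
    and zero: "\<And>x. x \<in> \<Omega> \<Longrightarrow> (\<Sum>i<length \<phi>. vec_index w i * (\<phi> ! i) x) = 0"
  shows "w = 0\<^sub>v (length \<phi>)"
proof -
  obtain vs where vs: "set vs = nodes \<Omega> \<T>" "length \<phi> = length vs"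
    and delta: "\<And>i j. i < length vs \<Longrightarrow> j < length vs \<Longrightarrow> (\<phi> ! i) (vs ! j) = (if i = j then 1 else 0)"
    using \<phi> unfolding nodal_basis_def by blast
  have "vec_index w j = 0" if "j < length \<phi>" for j
  proof -
    have "vs ! j \<in> nodes \<Omega> \<T>" using that vs nth_mem by metis
    then have "(\<Sum>i<length \<phi>. vec_index w i * (\<phi> ! i) (vs ! j)) = 0"
      by (intro zero) (simp add: nodes_def)
    also have "(\<Sum>i<length \<phi>. vec_index w i * (\<phi> ! i) (vs ! j)) = (\<Sum>i<length \<phi>. if i = j then vec_index w i else 0)"
      using that vs(2) by (intro sum.cong) (auto simp: delta)
    finally show ?thesis using that by simp
  qed
  with w show ?thesis by auto
qed

lemma nodal_basis_fe_space: "nodal_basis \<Omega> \<T> \<phi> \<Longrightarrow> i < length \<phi> \<Longrightarrow> \<phi> ! i \<in> fe_space \<Omega> \<T>"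
  by (auto simp: nodal_basis_def)

text \<open>The pointwise quadratic form is the square of a finite element function. If that
  function vanishes almost everywhere, its open set of nonzero points in \<Omega> is empty.\<close>

lemma mass_positive_form:
  assumes \<phi>: "nodal_basis \<Omega> \<T> \<phi>"
  shows "positive_form (length \<phi>) (mass_matrix \<Omega> \<phi>)"
  unfolding mass_matrix_def
proof (rule gram_positive_form)
  let ?u = "\<lambda>w x. \<Sum>i<length \<phi>. vec_index w i * (\<phi> ! i) x"
  have square: "(\<Sum>i<length \<phi>. \<Sum>j<length \<phi>. (\<phi> ! i) x * (\<phi> ! j) x * vec_index w j * vec_index w i) = (?u w x)\<^sup>2" for w x
    by (simp add: power2_eq_square sum_product mult_ac)
  fix w :: "real Matrix.vec" and x
  show "0 \<le> (\<Sum>i<length \<phi>. \<Sum>j<length \<phi>. (\<phi> ! i) x * (\<phi> ! j) x * vec_index w j * vec_index w i)"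
    unfolding square by simp
  assume w: "w \<in> carrier_vec (length \<phi>)"
    and "AE x in lebesgue_on \<Omega>. (\<Sum>i<length \<phi>. \<Sum>j<length \<phi>. (\<phi> ! i) x * (\<phi> ! j) x * vec_index w j * vec_index w i) = 0"
  then have ae: "AE x in lebesgue_on \<Omega>. ?u w x = 0" unfolding square by simp
  have "?u w \<in> fe_space \<Omega> \<T>" by (intro fe_space_sum nodal_basis_fe_space[OF \<phi>])
  then have "continuous_on \<Omega> (?u w)"
    using continuous_on_subset[OF _ closure_subset] by (auto simp: fe_space_def)
  then have op: "open (\<Omega> \<inter> ?u w -` (- {0}))"
    using domain(1) by (intro continuous_open_preimage) auto
  have "?u w x = 0" if "x \<in> \<Omega>" for x
  proof (rule ccontr)
    assume "?u w x \<noteq> 0"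
    with that have "\<Omega> \<inter> ?u w -` (- {0}) \<inter> \<Omega> \<noteq> {}" by blast
    from AE_lebesgue_on_obtain_open[OF ae domain(1) op this] show False by blast
  qed
  then show "w = 0\<^sub>v (length \<phi>)" by (rule nodal_coefficients_zero[OF \<phi> w])
qed (use integrable_mass nodal_basis_fe_space[OF \<phi>] in auto)

text \<open>The pointwise quadratic form is the energy density of the combined gradient. Coercivity
  makes that gradient vanish almost everywhere, and \<open>fe_space_grad_zero\<close>
  applies.\<close>

lemma stiffness_positive_form:
  assumes \<phi>: "nodal_basis \<Omega> \<T> \<phi>" and a: "diffusion_coefficient \<Omega> a"
  shows "positive_form (length \<phi>) (stiffness_matrix \<Omega> a \<phi>)"
  unfolding stiffness_matrix_def
proof (rule gram_positive_form)
  let ?G = "\<lambda>w x. \<Sum>i<length \<phi>. vec_index w i *\<^sub>R grad (\<phi> ! i) x"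
  let ?q = "\<lambda>w x. \<Sum>i<length \<phi>. \<Sum>j<length \<phi>.
    inner (a x *v grad (\<phi> ! i) x) (grad (\<phi> ! j) x) * vec_index w j * vec_index w i"
  have bilinear: "?q w x = inner (a x *v ?G w x) (?G w x)" for w x
    by (simp add: linear_sum[OF matrix_vector_mul_linear] matrix_vector_mult_scaleR
        inner_sum_left inner_sum_right sum_distrib_left mult_ac)
      (subst sum.swap, simp add: mult.left_commute)
  obtain c where c: "0 < c" "\<And>x v. x \<in> \<Omega> \<Longrightarrow> c * (norm v)\<^sup>2 \<le> inner (a x *v v) v"
    using coefficient_bounds[OF a] by metis
  fix w :: "real Matrix.vec"
  show "0 \<le> ?q w x" if "x \<in> space (lebesgue_on \<Omega>)" for x
  proof -
    have "0 \<le> c * (norm (?G w x))\<^sup>2" using c(1) by simp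
    also have "\<dots> \<le> inner (a x *v ?G w x) (?G w x)" using that domain_sets(2) by (intro c(2)) simp
    finally show ?thesis unfolding bilinear .
  qed
  assume w: "w \<in> carrier_vec (length \<phi>)" and ae: "AE x in lebesgue_on \<Omega>. ?q w x = 0"
  have pointwise: "grad (\<lambda>x. \<Sum>i<length \<phi>. vec_index w i * (\<phi> ! i) x) x = 0"
    if "?q w x = 0" "x \<in> cell_interiors" "x \<in> \<Omega>" for x
  proof -
    have "c * (norm (?G w x))\<^sup>2 \<le> 0"
      using c(2)[OF that(3), of "?G w x"] that(1) unfolding bilinear by simp
    with c(1) have "?G w x = 0" by (simp add: mult_le_0_iff)
    then show ?thesis by (simp add: grad_sum[OF nodal_basis_fe_space[OF \<phi>] that(2)])
  qed
  have "AE x in lebesgue_on \<Omega>. grad (\<lambda>x. \<Sum>i<length \<phi>. vec_index w i * (\<phi> ! i) x) x = 0"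
    by (rule eventually_mono[OF eventually_conj[OF ae eventually_conj[OF AE_cell_interiors AE_space]]])
      (use pointwise domain_sets(2) in blast)
  from fe_space_grad_zero[OF fe_space_sum[OF nodal_basis_fe_space[OF \<phi>]] this]
  show "w = 0\<^sub>v (length \<phi>)" by (rule nodal_coefficients_zero[OF \<phi> w])
qed (use integrable_stiffness[OF a] nodal_basis_fe_space[OF \<phi>] coefficient_inner_commute[OF a] domain_sets in auto)

end

section \<open>Application to every mesh of the family\<close>

lemma lumped_symmetric_form: "P \<in> carrier_mat n n \<Longrightarrow> symmetric_form n (lumped P)"
  by (auto simp: symmetric_form_def lumped_def)

lemma smult_positive_form:
  assumes "positive_form n P" "0 < r"
  shows "positive_form n (r \<cdot>\<^sub>m P)"
  using assms by (auto simp: positive_form_def symmetric_form_def mult_scalar_prod_sum[where n = n]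
      mult.assoc sum_distrib_left[symmetric])

text \<open>Invertibility is part of the conclusion so that \<open>the (mat_inverse ...)\<close>
  denotes a genuine inverse. The spectrum is taken over the complex numbers, so the inclusion also
  asserts that all eigenvalues are real.\<close>

theorem theorem2:
  fixes \<Omega> :: "(real ^ 'd) set"
    and a b :: "real ^ 'd \<Rightarrow> real ^ 'd ^ 'd"
    and \<M> :: "(real ^ 'd) set set set"
    and \<phi> :: "(real ^ 'd) set set \<Rightarrow> (real ^ 'd \<Rightarrow> real) list"
    and C\<^sub>1 :: real
  assumes "polyhedral_domain \<Omega>"
    and "diffusion_coefficient \<Omega> a" and "diffusion_coefficient \<Omega> b"
    and "\<forall>\<T>\<in>\<M>. mesh \<Omega> \<T>" and "shape_regular \<M>"
    and "\<forall>\<T>\<in>\<M>. nodal_basis \<Omega> \<T> (\<phi> \<T>)"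
    and "0 < C\<^sub>1" and "C\<^sub>1 < 1"
    and "\<forall>\<T>\<in>\<M>. \<forall>w \<in> carrier_vec (length (\<phi> \<T>)).
           C\<^sub>1 * scalar_prod (lumped (mass_matrix \<Omega> (\<phi> \<T>)) *\<^sub>v w) w
             \<le> scalar_prod (mass_matrix \<Omega> (\<phi> \<T>) *\<^sub>v w) w \<and>
           scalar_prod (mass_matrix \<Omega> (\<phi> \<T>) *\<^sub>v w) w
             \<le> scalar_prod (lumped (mass_matrix \<Omega> (\<phi> \<T>)) *\<^sub>v w) w"
  shows "\<forall>\<T>\<in>\<M>. \<forall>\<tau>>0.
           let M = mass_matrix \<Omega> (\<phi> \<T>);
               A = stiffness_matrix \<Omega> a (\<phi> \<T>);
               B = stiffness_matrix \<Omega> b (\<phi> \<T>)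
           in A = B \<longrightarrow>
                invertible_mat (calB_tilde \<tau> A B M) \<and>
                spectrum (map_mat complex_of_real (the (mat_inverse (calB_tilde \<tau> A B M)) * calA \<tau> A B M))
                  \<subseteq> complex_of_real ` {C\<^sub>1<..1}"
  unfolding Let_def
proof (intro ballI allI impI)
  fix \<T> and \<tau> :: real
  assume \<T>: "\<T> \<in> \<M>" and \<tau>: "0 < \<tau>"
    and eq: "stiffness_matrix \<Omega> a (\<phi> \<T>) = stiffness_matrix \<Omega> b (\<phi> \<T>)"
  interpret fe_mesh \<Omega> \<T>
    using assms(1,4) \<T> by unfold_locales auto
  have \<phi>: "nodal_basis \<Omega> \<T> (\<phi> \<T>)" using assms(6) \<T> by blast
  note M = mass_positive_form[OF \<phi>]
  note K = smult_positive_form[OF stiffness_positive_form[OF \<phi> assms(2)] \<tau>]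
  have L: "symmetric_form (length (\<phi> \<T>)) (lumped (mass_matrix \<Omega> (\<phi> \<T>)))"
    by (rule lumped_symmetric_form) (simp add: mass_matrix_def)
  show "invertible_mat (calB_tilde \<tau> (stiffness_matrix \<Omega> a (\<phi> \<T>)) (stiffness_matrix \<Omega> b (\<phi> \<T>)) (mass_matrix \<Omega> (\<phi> \<T>))) \<and>
    spectrum (map_mat complex_of_real
      (the (mat_inverse (calB_tilde \<tau> (stiffness_matrix \<Omega> a (\<phi> \<T>)) (stiffness_matrix \<Omega> b (\<phi> \<T>)) (mass_matrix \<Omega> (\<phi> \<T>)))) *
        calA \<tau> (stiffness_matrix \<Omega> a (\<phi> \<T>)) (stiffness_matrix \<Omega> b (\<phi> \<T>)) (mass_matrix \<Omega> (\<phi> \<T>))))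
      \<subseteq> complex_of_real ` {C\<^sub>1<..1}"
    \<comment> \<open>Rewriting the second stiffness matrix to the first turns the diagonal blocks
      into \<open>K\<close> and \<open>- K\<close> for one matrix \<open>K\<close>, the stiffness
      matrix scaled by \<open>\<tau>\<close>.\<close>
    unfolding eq[symmetric] calA_def calB_tilde_def
    using block_preconditioner[OF M K L assms(7,8)] assms(9) \<T> by blast
qed

end
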